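(* The nonlocal $H$-limit is unique: let $\alpha,\beta>0$, let $(a_n)_n$ be a sequence in $\mathcal{M}(\alpha,\beta,(A_0,A_1))$, and let $a,b\in L(H_1)$ be continuously invertible. If $(a_n)_n$ nonlocally $H$-converges to $a$ and nonlocally $H$-converges to $b$ with respect to $(A_0,A_1)$, then $a=b$.
   Context: Hilbert spaces are complex; $L(K_0,K_1)$ denotes bounded linear operators, $L(K)=L(K,K)$. $K^*$ is the space of bounded functionals on $K$, with the convention (linear or conjugate-linear) that $v\mapsto\langle w,v\rangle$ belongs to $K^*$. For $T\in L(K)$, $\operatorname{Re}T=\frac12(T+T^* )$, and $\operatorname{Re}T\ge c$ means $\operatorname{Re}\langle T\phi,\phi\rangle\ge c\|\phi\|^2$ for all $\phi$. Standing setting: $H_0,H_1,H_2$ are Hilbert spaces; $A_0:\operatorname{dom}(A_0)\subseteq H_0\to H_1$ and $A_1:\operatorname{dom}(A_1)\subseteq H_1\to H_2$ are densely defined closed linear operators; $(A_0,A_1)$ is closed and exact, i.e. $\operatorname{ran}(A_0)$, $\operatorname{ran}(A_1)$ are closed and $\operatorname{ran}(A_0)=\ker(A_1)$. Then $H_1=\operatorname{ran}(A_0)\oplus\operatorname{ran}(A_1^* )$ orthogonally. Let $\iota_0:\operatorname{ran}(A_0)\hookrightarrow H_1$ and $\iota_1:\operatorname{ran}(A_1^* )\hookrightarrow H_1$ be the canonical embeddings. For $a\in L(H_1)$ put $a_{jk}=\iota_j^*a\iota_k$ ($j,k\in\{0,1\}$); $a_{00}^{-1}$ means $(a_{00})^{-1}$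 and $(a^{-1})_{11}^{-1}$ means $((a^{-1})_{11})^{-1}$. For $\alpha,\beta>0$, $\mathcal{M}(\alpha,\beta,(A_0,A_1))$ is the set of continuously invertible $a\in L(H_1)$ with $\operatorname{Re}a_{00}\ge\alpha$, $\operatorname{Re}a_{00}^{-1}\ge1/\beta$, $\operatorname{Re}(a^{-1})_{11}\ge1/\beta$, $\operatorname{Re}(a^{-1})_{11}^{-1}\ge\alpha$. Let $\mathcal{A}_0$ be $A_0$ restricted to $\operatorname{dom}(\mathcal{A}_0)=\operatorname{dom}(A_0)\cap\operatorname{ran}(A_0^* )$ (note $\operatorname{ran}(A_0^* )=\ker(A_0)^\perp$), with values in $\operatorname{ran}(A_0)$, and $\mathcal{A}_1^*$ be $A_1^*$ restricted to $\operatorname{dom}(\mathcal{A}_1^* )=\operatorname{dom}(A_1^* )\cap\operatorname{ran}(A_1)$, with values in $\operatorname{ran}(A_1^* )$; domains carry graph norms. Nonlocal $H$-convergence: a sequence $(a_n)_n$ in $\mathcal{M}(\alpha,\beta,(A_0,A_1))$ is nonlocally $H$-convergent to a continuously invertible $a\in L(H_1)$ with respect to $(A_0,A_1)$ (and $a$ is then called a nonlocal $H$-limit) if for all $f\in\operatorname{dom}(\mathcal{A}_0)^*$ and $g\in\operatorname{dom}(\mathcal{A}_1^* )^*$, the (unique) $u_n\in\operatorname{dom}(\mathcal{A}_0)$, $v_n\in\operatorname{dom}(\mathcal{A}_1^* )$ with $\langle a_nA_0u_n,A_0\phi\rangle=f(\phi)$ and $\langle a_n^{-1}A_1^*v_n,A_1^*\psi\rangle=g(\psi)$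 for all $\phi\in\operatorname{dom}(\mathcal{A}_0)$, $\psi\in\operatorname{dom}(\mathcal{A}_1^* )$ satisfy: $u_n\rightharpoonup u$ weakly in $\operatorname{dom}(A_0)$ for some $u$; $v_n\rightharpoonup v$ weakly in $\operatorname{dom}(A_1^* )$ for some $v$; $a_nA_0u_n\rightharpoonup aA_0u$ and $a_n^{-1}A_1^*v_n\rightharpoonup a^{-1}A_1^*v$ weakly in $H_1$; and $\langle aA_0u,A_0\phi\rangle=f(\phi)$, $\langle a^{-1}A_1^*v,A_1^*\psi\rangle=g(\psi)$ for all $\phi\in\operatorname{dom}(\mathcal{A}_0)$, $\psi\in\operatorname{dom}(\mathcal{A}_1^* )$. *)

theory Defs
  imports "HOL-Analysis.Analysis"
begin

(* Complex Hilbert spaces. The real structure, norm and topology are those of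
   real_inner and banach; the complex structure is tied to them by the axioms scaleC_of_real and
   inner_eq_Re_cinner, so that norm x ^ 2 = cinner x x. The inner product is conjugate-linear in
   the first and linear in the second argument. *)

class chilbert_space = real_inner + banach +
  fixes scaleC :: "complex \<Rightarrow> 'a \<Rightarrow> 'a" (infixr "*\<^sub>C" 75)
    and cinner :: "'a \<Rightarrow> 'a \<Rightarrow> complex"
  assumes scaleC_add_right: "c *\<^sub>C (x + y) = c *\<^sub>C x + c *\<^sub>C y"
    and scaleC_add_left: "(c + d) *\<^sub>C x = c *\<^sub>C x + d *\<^sub>C x"
    and scaleC_scaleC: "c *\<^sub>C d *\<^sub>C x = (c * d) *\<^sub>C x"
    and scaleC_of_real: "complex_of_real r *\<^sub>C x = r *\<^sub>R x"
    and cinner_commute: "cinner x y = cnj (cinner y x)"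
    and cinner_add_right: "cinner x (y + z) = cinner x y + cinner x z"
    and cinner_scaleC_right: "cinner x (c *\<^sub>C y) = c * cinner x y"
    and inner_eq_Re_cinner: "x \<bullet> y = Re (cinner x y)"

instantiation complex :: chilbert_space
begin

definition scaleC_complex :: "complex \<Rightarrow> complex \<Rightarrow> complex" where
  "scaleC_complex c x = c * x"

definition cinner_complex :: "complex \<Rightarrow> complex \<Rightarrow> complex" where
  "cinner_complex x y = cnj x * y"

instance
  by standard
    (simp_all add: scaleC_complex_def cinner_complex_def inner_complex_def
      algebra_simps scaleR_conv_of_real)

end

definition csubspace :: "'a::chilbert_space set \<Rightarrow> bool" where
  "csubspace S \<longleftrightarrow>
     0 \<in> S \<and> (\<forall>x\<in>S. \<forall>y\<in>S. x + y \<in> S) \<and> (\<forall>c. \<forall>x\<in>S. c *\<^sub>C x \<in> S)"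

definition clinear_on :: "'a::chilbert_space set \<Rightarrow> ('a \<Rightarrow> 'b::chilbert_space) \<Rightarrow> bool" where
  "clinear_on S f \<longleftrightarrow>
     (\<forall>x\<in>S. \<forall>y\<in>S. f (x + y) = f x + f y) \<and> (\<forall>c. \<forall>x\<in>S. f (c *\<^sub>C x) = c *\<^sub>C f x)"

(* L(S) for a subspace S (UNIV for the whole space); values outside S are irrelevant. *)
definition bounded_ops :: "'a::chilbert_space set \<Rightarrow> ('a \<Rightarrow> 'a) set" where
  "bounded_ops S =
     {T. T ` S \<subseteq> S \<and> clinear_on S T \<and> (\<exists>C. \<forall>x\<in>S. norm (T x) \<le> C * norm x)}"

definition cont_invertible_on :: "'a::chilbert_space set \<Rightarrow> ('a \<Rightarrow> 'a) \<Rightarrow> bool" where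
  "cont_invertible_on S T \<longleftrightarrow>
     T \<in> bounded_ops S \<and> bij_betw T S S \<and> inv_into S T \<in> bounded_ops S"

definition Re_ge_on :: "'a::chilbert_space set \<Rightarrow> ('a \<Rightarrow> 'a) \<Rightarrow> real \<Rightarrow> bool" where
  "Re_ge_on S T c \<longleftrightarrow> (\<forall>x\<in>S. Re (cinner (T x) x) \<ge> c * (norm x)\<^sup>2)"

(* The bounded complex-linear functionals on the subspace D with norm N. *)
definition dual :: "'a::chilbert_space set \<Rightarrow> ('a \<Rightarrow> real) \<Rightarrow> ('a \<Rightarrow> complex) set" where
  "dual D N = {f. clinear_on D f \<and> (\<exists>C. \<forall>x\<in>D. cmod (f x) \<le> C * N x)}"

definition weakly_converges ::
  "'a::chilbert_space set \<Rightarrow> ('a \<Rightarrow> real) \<Rightarrow> (nat \<Rightarrow> 'a) \<Rightarrow> 'a \<Rightarrow> bool" where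
  "weakly_converges D N x l \<longleftrightarrow>
     range x \<subseteq> D \<and> l \<in> D \<and> (\<forall>f\<in>dual D N. (\<lambda>n. f (x n)) \<longlonglongrightarrow> f l)"


(* An operator A with domain of definition dom A is a partial function, with range ran A and
   graph Map.graph A; app A x is its value at a point x of dom A. *)

abbreviation app :: "('a \<rightharpoonup> 'b) \<Rightarrow> 'a \<Rightarrow> 'b" where
  "app A x \<equiv> the (A x)"

definition linear_op :: "('a::chilbert_space \<rightharpoonup> 'b::chilbert_space) \<Rightarrow> bool" where
  "linear_op A \<longleftrightarrow> csubspace (dom A) \<and> clinear_on (dom A) (app A)"

definition densely_defined_closed :: "('a::chilbert_space \<rightharpoonup> 'b::chilbert_space) \<Rightarrow> bool" where
  "densely_defined_closed A \<longleftrightarrow>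
     linear_op A \<and> closure (dom A) = UNIV \<and> closed (Map.graph A)"

definition kernel :: "('a \<rightharpoonup> 'b::zero) \<Rightarrow> 'a set" where
  "kernel A = {x \<in> dom A. app A x = 0}"

(* The adjoint; z is unique when dom A is dense. *)
definition adj :: "('a::chilbert_space \<rightharpoonup> 'b::chilbert_space) \<Rightarrow> ('b \<rightharpoonup> 'a)" where
  "adj A = (\<lambda>y.
     if \<exists>z. \<forall>x\<in>dom A. cinner (app A x) y = cinner x z
     then Some (THE z. \<forall>x\<in>dom A. cinner (app A x) y = cinner x z)
     else None)"

definition closed_exact ::
  "('a::chilbert_space \<rightharpoonup> 'b::chilbert_space) \<Rightarrow> ('b \<rightharpoonup> 'c::chilbert_space) \<Rightarrow> bool" where
  "closed_exact A0 A1 \<longleftrightarrow> closed (ran A0) \<and> closed (ran A1) \<and> ran A0 = kernel A1"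

definition graph_norm :: "('a::chilbert_space \<rightharpoonup> 'b::chilbert_space) \<Rightarrow> 'a \<Rightarrow> real" where
  "graph_norm A x = sqrt ((norm x)\<^sup>2 + (norm (app A x))\<^sup>2)"

(* The adjoint of the embedding of a closed subspace S into the whole space. *)
definition embed_adj :: "'a::chilbert_space set \<Rightarrow> 'a \<Rightarrow> 'a" where
  "embed_adj S x = (THE y. y \<in> S \<and> (\<forall>s\<in>S. cinner y s = cinner x s))"

(* The diagonal block a_jj of a, as an operator on S, where S is the j-th summand. *)
definition block :: "'a::chilbert_space set \<Rightarrow> ('a \<Rightarrow> 'a) \<Rightarrow> 'a \<Rightarrow> 'a" where
  "block S a = (\<lambda>x. embed_adj S (a x))"

(* Invertibility of the two blocks, presupposed by the notation for their inverses, follows from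
   their coercivity (Lax-Milgram); it is listed so that inv_into is meaningful. *)
definition M_class ::
  "real \<Rightarrow> real \<Rightarrow> ('a::chilbert_space \<rightharpoonup> 'b::chilbert_space) \<Rightarrow> ('b \<rightharpoonup> 'c::chilbert_space)
    \<Rightarrow> ('b \<Rightarrow> 'b) set" where
  "M_class \<alpha> \<beta> A0 A1 = {a.
     cont_invertible_on UNIV a \<and>
     (let R0 = ran A0; R1 = ran (adj A1); a00 = block R0 a; ainv11 = block R1 (inv a) in
        cont_invertible_on R0 a00 \<and> cont_invertible_on R1 ainv11 \<and>
        Re_ge_on R0 a00 \<alpha> \<and> Re_ge_on R0 (inv_into R0 a00) (1 / \<beta>) \<and>
        Re_ge_on R1 ainv11 (1 / \<beta>) \<and> Re_ge_on R1 (inv_into R1 ainv11) \<alpha>)}"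

definition red0 :: "('a::chilbert_space \<rightharpoonup> 'b::chilbert_space) \<Rightarrow> ('a \<rightharpoonup> 'b)" where
  "red0 A0 = A0 |` ran (adj A0)"

definition red1_adj :: "('b::chilbert_space \<rightharpoonup> 'c::chilbert_space) \<Rightarrow> ('c \<rightharpoonup> 'b)" where
  "red1_adj A1 = adj A1 |` ran A1"

definition var_solution ::
  "('a::chilbert_space \<rightharpoonup> 'b::chilbert_space) \<Rightarrow> ('b \<Rightarrow> 'b) \<Rightarrow> ('a \<Rightarrow> complex) \<Rightarrow> 'a \<Rightarrow> bool" where
  "var_solution B a f u \<longleftrightarrow>
     u \<in> dom B \<and> (\<forall>\<phi>\<in>dom B. cinner (a (app B u)) (app B \<phi>) = f \<phi>)"

(* For a sequence in M_class the solutions u n and v n exist and are unique, so quantifying over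
   all sequences of solutions refers to exactly one u and one v. *)
definition nonlocal_H_convergent ::
  "('a::chilbert_space \<rightharpoonup> 'b::chilbert_space) \<Rightarrow> ('b \<rightharpoonup> 'c::chilbert_space)
    \<Rightarrow> (nat \<Rightarrow> 'b \<Rightarrow> 'b) \<Rightarrow> ('b \<Rightarrow> 'b) \<Rightarrow> bool" where
  "nonlocal_H_convergent A0 A1 an a \<longleftrightarrow>
     (\<forall>f \<in> dual (dom (red0 A0)) (graph_norm (red0 A0)).
      \<forall>g \<in> dual (dom (red1_adj A1)) (graph_norm (red1_adj A1)).
      \<forall>u v.
        (\<forall>n. var_solution (red0 A0) (an n) f (u n)) \<and>
        (\<forall>n. var_solution (red1_adj A1) (inv (an n)) g (v n)) \<longrightarrow>
        (\<exists>ul vl.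
           weakly_converges (dom A0) (graph_norm A0) u ul \<and>
           weakly_converges (dom (adj A1)) (graph_norm (adj A1)) v vl \<and>
           weakly_converges UNIV norm (\<lambda>n. an n (app A0 (u n))) (a (app A0 ul)) \<and>
           weakly_converges UNIV norm
             (\<lambda>n. inv (an n) (app (adj A1) (v n))) (inv a (app (adj A1) vl)) \<and>
           (\<forall>\<phi>\<in>dom (red0 A0). cinner (a (app A0 ul)) (app A0 \<phi>) = f \<phi>) \<and>
           (\<forall>\<psi>\<in>dom (red1_adj A1).
              cinner (inv a (app (adj A1) vl)) (app (adj A1) \<psi>) = g \<psi>)))"

end

theory Submission
  imports Defs
begin

text \<open>Let \<open>R0\<close> be the range of \<^term>\<open>A0\<close> and \<open>R1\<close> the range of the adjoint of \<^term>\<open>A1\<close>; they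
  are orthogonal and span the space.  Solving the first variational problem with right-hand side
  \<^term>\<open>\<lambda>\<phi>. cinner h (app A0 \<phi>)\<close> means applying the inverse of the \<open>R0\<close>-block of \<^term>\<open>an n\<close> to
  \<^term>\<open>h\<close>.  Nonlocal H-convergence to \<^term>\<open>a\<close> thus says that these inverses converge weakly,
  pointwise, to an operator \<open>T\<close> on \<open>R0\<close>, that the \<open>R0\<close>-block of \<^term>\<open>a\<close> is a left inverse of \<open>T\<close>,
  and that \<^term>\<open>a\<close> maps \<open>T h\<close> to the weak limit of the fluxes.  Neither \<open>T\<close> nor the fluxes depend
  on the limit, so \<^term>\<open>a\<close> and \<^term>\<open>b\<close> agree on the range of \<open>T\<close>.

  The point is that \<open>T\<close> is onto \<open>R0\<close>, although coercivity is known for the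
  \<^term>\<open>an n\<close> only: the bounds in the definition of \<^term>\<open>M_class \<alpha> \<beta> A0 A1\<close> survive the weak
  limit in the form of boundedness and coercivity of \<open>T\<close>, and
  Lax--Milgram applies to \<open>T\<close> (\<open>block_limit_surj\<close>).  In the same way \<^term>\<open>inv a\<close> and \<^term>\<open>inv b\<close>
  agree on \<open>R1\<close>, and the \<open>R1\<close>-block of \<^term>\<open>inv a\<close> is onto \<open>R1\<close>.  The latter means that every
  \<open>x\<close> is \<open>r + inv a w\<close> with \<open>r\<close> in \<open>R0\<close> and \<open>w\<close> in \<open>R1\<close>, and on both summands \<^term>\<open>a\<close> and
  \<^term>\<open>b\<close> agree.

  The translation between operators and blocks needs that the reduced operators still have the
  ranges \<open>R0\<close> and \<open>R1\<close> and that \<open>R1\<close> is the orthogonal complement of the kernel of \<^term>\<open>A1\<close>.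
  The main tool is the closed range theorem (\<open>ran_adj\<close>), which is obtained from Riesz representation
  and the open mapping theorem for closed linear relations.  Since the real part of the complex
  inner product is the real one, the functional analysis is done over the reals.\<close>

section \<open>Closed subspaces of real Hilbert spaces\<close>

text \<open>The functional \<^term>\<open>J s = (norm s)\<^sup>2 - 2 * F s\<close> is bounded below, and by the parallelogram law
  every minimising sequence is Cauchy.  The derivative of \<^term>\<open>J\<close> vanishes at the minimiser, and
  this is the representation of \<^term>\<open>F\<close>.  Working on a subspace makes orthogonal projection the
  special case where \<^term>\<open>F\<close> is an inner product with a fixed vector.\<close>

lemma riesz_on_closed_subspace:
  fixes S :: "'a::{real_inner,banach} set" and F :: "'a \<Rightarrow> real"
  assumes sub: "subspace S" and cl: "closed S"
    and add: "\<And>x y. x \<in> S \<Longrightarrow> y \<in> S \<Longrightarrow> F (x + y) = F x + F y"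
    and scale: "\<And>r x. x \<in> S \<Longrightarrow> F (r *\<^sub>R x) = r * F x"
    and bound: "\<And>x. x \<in> S \<Longrightarrow> \<bar>F x\<bar> \<le> C * norm x"
  obtains z where "z \<in> S" "\<And>s. s \<in> S \<Longrightarrow> F s = z \<bullet> s"
proof -
  define J where "J s = (norm s)\<^sup>2 - 2 * F s" for s
  define m where "m = Inf (J ` S)"
  have zero: "0 \<in> S" using sub by (rule subspace_0)
  have lower: "- C\<^sup>2 \<le> J s" if "s \<in> S" for s
  proof -
    have "0 \<le> (norm s - C)\<^sup>2" by simp
    then show ?thesis using bound[OF that] by (simp add: J_def power2_eq_square algebra_simps)
  qed
  have bdd: "bdd_below (J ` S)" using lower by (auto intro!: bdd_belowI)
  have m_le: "m \<le> J s" if "s \<in> S" for s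
    unfolding m_def using bdd that by (simp add: cInf_lower)
  have "\<exists>s\<in>S. J s < m + 1 / real (Suc n)" for n
  proof -
    have "Inf (J ` S) < m + 1 / real (Suc n)" by (simp add: m_def)
    then show ?thesis using cInf_lessD[of "J ` S"] zero by blast
  qed
  then obtain s where s: "\<And>n. s n \<in> S" "\<And>n. J (s n) < m + 1 / real (Suc n)" by metis
  have para: "(norm (x - y))\<^sup>2 \<le> 2 * (J x - m) + 2 * (J y - m)" if "x \<in> S" "y \<in> S" for x y
  proof -
    have h: "(1/2) *\<^sub>R (x + y) \<in> S" using that sub by (simp add: subspace_add subspace_scale)
    have "F ((1/2) *\<^sub>R (x + y)) = (F x + F y) / 2"
      using that scale[of "x + y" "1/2"] by (simp add: add subspace_add[OF sub])
    moreover have "norm ((1/2) *\<^sub>R (x + y)) = norm (x + y) / 2" by simp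
    ultimately have "J ((1/2) *\<^sub>R (x + y)) = (norm (x + y))\<^sup>2 / 4 - (F x + F y)"
      unfolding J_def by (simp add: power_divide)
    moreover have "(norm (x - y))\<^sup>2 = 2 * (norm x)\<^sup>2 + 2 * (norm y)\<^sup>2 - (norm (x + y))\<^sup>2"
      by (simp add: power2_norm_eq_inner inner_commute algebra_simps)
    ultimately show ?thesis using m_le[OF h] by (simp add: J_def)
  qed
  have "Cauchy s"
  proof (rule metric_CauchyI)
    fix e :: real assume "e > 0"
    then obtain N where N: "4 / e\<^sup>2 < real (Suc N)"
      by (meson reals_Archimedean2 less_trans lessI of_nat_less_iff)
    have "dist (s k) (s n) < e" if "k \<ge> N" "n \<ge> N" for k n
    proof -
      have "1 / real (Suc k) \<le> 1 / real (Suc N)" "1 / real (Suc n) \<le> 1 / real (Suc N)"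
        using that by (simp_all add: frac_le)
      then have "(norm (s k - s n))\<^sup>2 < 4 / real (Suc N)"
        using para[OF s(1) s(1), of k n] s(2)[of k] s(2)[of n] by simp
      also have "\<dots> < e\<^sup>2" using N \<open>e > 0\<close> by (simp add: field_simps)
      finally show ?thesis unfolding dist_norm
        by (rule power2_less_imp_less) (simp add: \<open>e > 0\<close> less_imp_le)
    qed
    then show "\<exists>N. \<forall>k\<ge>N. \<forall>n\<ge>N. dist (s k) (s n) < e" by blast
  qed
  then obtain z where z: "s \<longlonglongrightarrow> z" using Cauchy_convergent convergent_def by blast
  have zS: "z \<in> S" using closed_sequentially[OF cl] s(1) z by blast
  have diff: "F (x - y) = F x - F y" if "x \<in> S" "y \<in> S" for x y
    using add[of x "-1 *\<^sub>R y"] scale[of y "-1"] that subspace_neg[OF sub, of y] by simp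
  have "(\<lambda>n. F (s n)) \<longlonglongrightarrow> F z"
  proof -
    have "(\<lambda>n. C * norm (s n - z)) \<longlonglongrightarrow> C * norm (z - z)" by (intro tendsto_intros z)
    then have "(\<lambda>n. F (s n) - F z) \<longlonglongrightarrow> 0"
      using bound[OF subspace_diff[OF sub s(1) zS]]
      by (intro Lim_null_comparison[of "\<lambda>n. F (s n) - F z" "\<lambda>n. C * norm (s n - z)"])
        (auto simp: diff s(1) zS)
    then show ?thesis by (simp add: LIM_zero_iff)
  qed
  then have "(\<lambda>n. J (s n)) \<longlonglongrightarrow> J z" unfolding J_def by (intro tendsto_intros z)
  moreover have "(\<lambda>n. m + 1 / real (Suc n)) \<longlonglongrightarrow> m + 0"
    by (intro tendsto_intros LIMSEQ_Suc[OF lim_1_over_n])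
  ultimately have "J z \<le> m + 0"
    using s(2) by (meson LIMSEQ_le less_imp_le)
  then have min: "J z \<le> J y" if "y \<in> S" for y using m_le[OF that] by simp
  have "F x = z \<bullet> x" if x: "x \<in> S" for x
  proof -
    define d where "d = z \<bullet> x - F x"
    have quad: "0 \<le> t\<^sup>2 * (norm x)\<^sup>2 + 2 * t * d" for t
    proof -
      have "(norm (z + t *\<^sub>R x))\<^sup>2 = (norm z)\<^sup>2 + t\<^sup>2 * (norm x)\<^sup>2 + 2 * t * (z \<bullet> x)"
        unfolding power2_norm_eq_inner
        by (simp add: inner_commute algebra_simps) (simp add: power2_eq_square)
      then have "J (z + t *\<^sub>R x) = J z + t\<^sup>2 * (norm x)\<^sup>2 + 2 * t * d"
        using x zS
        by (simp add: J_def d_def add scale subspace_scale[OF sub] algebra_simps)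
      then show ?thesis using min[of "z + t *\<^sub>R x"] x zS sub
        by (simp add: subspace_add subspace_scale)
    qed
    have "d = 0"
    proof (cases "x = 0")
      case True
      then show ?thesis using scale[OF zero, of 0] by (simp add: d_def)
    next
      case False
      then have "0 \<le> - (d\<^sup>2 / (norm x)\<^sup>2)"
        using quad[of "- d / (norm x)\<^sup>2"] by (simp add: power2_eq_square field_simps)
      then show ?thesis using False by (simp add: divide_le_0_iff)
    qed
    then show ?thesis by (simp add: d_def)
  qed
  with zS show ?thesis by (rule that)
qed

lemma orthogonal_projection:
  fixes S :: "'a::{real_inner,banach} set"
  assumes "subspace S" "closed S"
  obtains p where "p \<in> S" "\<And>s. s \<in> S \<Longrightarrow> (x - p) \<bullet> s = 0"
proof -
  obtain p where "p \<in> S" "\<And>s. s \<in> S \<Longrightarrow> x \<bullet> s = p \<bullet> s"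
    by (rule riesz_on_closed_subspace[OF assms, of "\<lambda>s. x \<bullet> s" "norm x"])
      (auto simp: inner_add_right Cauchy_Schwarz_ineq2)
  then show ?thesis using that by (simp add: inner_diff_left)
qed

text \<open>Lax--Milgram: for small \<^term>\<open>t > 0\<close> the map \<^term>\<open>x - t *\<^sub>R (T x - y)\<close> is a contraction of
  \<^term>\<open>S\<close>, and a fixed point of it solves \<^term>\<open>T x = y\<close>.\<close>

lemma coercive_imp_surj:
  fixes S :: "'a::{real_inner,banach} set" and T :: "'a \<Rightarrow> 'a"
  assumes sub: "subspace S" and cl: "closed S" and TS: "T ` S \<subseteq> S"
    and diff: "\<And>x y. x \<in> S \<Longrightarrow> y \<in> S \<Longrightarrow> T (x - y) = T x - T y"
    and bound: "\<And>x. x \<in> S \<Longrightarrow> norm (T x) \<le> C * norm x"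
    and coercive: "\<And>x. x \<in> S \<Longrightarrow> c * (norm x)\<^sup>2 \<le> T x \<bullet> x" and "c > 0"
    and y: "y \<in> S"
  obtains x where "x \<in> S" "T x = y"
proof -
  \<comment> \<open>With \<^term>\<open>D\<close> a bound of the operator norm, this \<^term>\<open>t\<close> minimises
    \<^term>\<open>1 - 2 * t * c + t\<^sup>2 * D\<^sup>2\<close>; adding \<^term>\<open>c\<close> ensures \<^term>\<open>c \<le> D\<close>, so that
    the minimum is a square.\<close>
  define D where "D = \<bar>C\<bar> + c"
  define t where "t = c / D\<^sup>2"
  have D: "D > 0" "c \<le> D" using \<open>c > 0\<close> by (simp_all add: D_def)
  have t: "t > 0" using D \<open>c > 0\<close> by (simp add: t_def)
  define q where "q = sqrt (1 - (c / D)\<^sup>2)"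
  have cD: "0 < c / D" "c / D \<le> 1" using D \<open>c > 0\<close> by simp_all
  then have "(c / D)\<^sup>2 \<le> 1" "0 < (c / D)\<^sup>2" by (auto intro!: power_le_one zero_less_power)
  then have q: "0 \<le> q" "q < 1" "q\<^sup>2 = 1 - (c / D)\<^sup>2" by (simp_all add: q_def)
  have contr: "norm (x - t *\<^sub>R T x) \<le> q * norm x" if x: "x \<in> S" for x
  proof -
    have "norm (T x) \<le> D * norm x"
      using bound[OF x] \<open>c > 0\<close> by (smt (verit) D_def mult_right_mono norm_ge_zero)
    then have Tx: "(norm (T x))\<^sup>2 \<le> D\<^sup>2 * (norm x)\<^sup>2"
      by (metis norm_ge_zero power_mono power_mult_distrib)
    have "(norm (x - t *\<^sub>R T x))\<^sup>2 = (norm x)\<^sup>2 - 2 * t * (T x \<bullet> x) + t\<^sup>2 * (norm (T x))\<^sup>2"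
      unfolding power2_norm_eq_inner
      by (simp add: inner_commute power2_eq_square algebra_simps)
    also have "\<dots> \<le> (norm x)\<^sup>2 - 2 * t * (c * (norm x)\<^sup>2) + t\<^sup>2 * (D\<^sup>2 * (norm x)\<^sup>2)"
      using t coercive[OF x] Tx by (intro add_mono diff_mono mult_left_mono) auto
    also have "\<dots> = (q * norm x)\<^sup>2"
      unfolding power_mult_distrib q(3) t_def using D
      by (simp add: field_simps power2_eq_square)
    finally show ?thesis by (rule power2_le_imp_le) (simp add: q(1))
  qed
  have "\<exists>!x\<in>S. x - t *\<^sub>R (T x - y) = x"
  proof (rule Banach_fix[OF _ _ q(1,2)])
    show "complete S" using cl by (simp add: complete_eq_closed)
    show "S \<noteq> {}" using y by blast
    show "(\<lambda>x. x - t *\<^sub>R (T x - y)) ` S \<subseteq> S"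
      using TS y by (auto intro!: subspace_diff[OF sub] subspace_scale[OF sub])
    fix u v assume "u \<in> S" "v \<in> S"
    then have "norm ((u - v) - t *\<^sub>R T (u - v)) \<le> q * norm (u - v)"
      using contr subspace_diff[OF sub] by blast
    then show "dist (u - t *\<^sub>R (T u - y)) (v - t *\<^sub>R (T v - y)) \<le> q * dist u v"
      using \<open>u \<in> S\<close> \<open>v \<in> S\<close> by (simp add: dist_norm diff algebra_simps)
  qed
  then obtain x where "x \<in> S" "T x = y" using t by auto
  then show ?thesis by (rule that)
qed

section \<open>Open mappings\<close>

text \<open>Baire's theorem yields approximate preimages of controlled norm for all small elements of
  the range.\<close>

lemma approx_preimage_bound:
  fixes G :: "('a::real_normed_vector \<times> 'b::banach) set"
  assumes sub: "subspace G" and cl: "closed (snd ` G)"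
  obtains C where "C \<ge> 0"
    "\<And>w e. w \<in> snd ` G \<Longrightarrow> e > 0 \<Longrightarrow> \<exists>x w'. (x, w') \<in> G \<and> norm x \<le> C * norm w \<and> norm (w - w') < e"
proof -
  let ?R = "snd ` G"
  define E where "E n = {w. \<exists>x. (x, w) \<in> G \<and> norm x \<le> real n}" for n
  have subR: "subspace ?R"
    by (intro linear_subspace_image sub linear_snd)
  have ER: "closure (E n) \<subseteq> ?R" for n
    by (rule closure_minimal[OF _ cl]) (force simp: E_def)
  have cover: "(\<Union>n. closure (E n)) = ?R"
  proof
    show "?R \<subseteq> (\<Union>n. closure (E n))"
    proof
      fix w assume "w \<in> ?R"
      then obtain x where "(x, w) \<in> G" by force
      moreover obtain n where "norm x \<le> real n" using real_arch_simple by blast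
      ultimately have "w \<in> E n" by (auto simp: E_def)
      then show "w \<in> (\<Union>n. closure (E n))" using closure_subset by blast
    qed
  qed (use ER in blast)
  have "\<exists>n. top_of_set ?R interior_of closure (E n) \<noteq> {}"
  proof (rule ccontr)
    assume "\<not> ?thesis"
    moreover have "closedin (top_of_set ?R) (closure (E n))" for n
      using ER by (simp add: closedin_closed_eq[OF cl])
    ultimately have "top_of_set ?R interior_of \<Union> (range (\<lambda>n. closure (E n))) = {}"
      using cl by (intro Baire_category_alt)
        (auto intro: completely_metrizable_space_closedin completely_metrizable_space_euclidean)
    then have "?R = {}" using interior_of_openin[of "top_of_set ?R" ?R] by (simp add: cover)
    then show False using subspace_0[OF subR] by blast
  qed
  then obtain n w0 where "w0 \<in> top_of_set ?R interior_of closure (E n)" by blast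
  then obtain U where U: "openin (top_of_set ?R) U" "w0 \<in> U" "U \<subseteq> closure (E n)"
    by (auto simp: interior_of_def)
  then obtain r where r: "r > 0" "ball w0 r \<inter> ?R \<subseteq> U"
    unfolding openin_contains_ball by blast
  have w0: "w0 \<in> ?R" "w0 \<in> closure (E n)" using U ER by auto
  define C where "C = 4 * real n / r"
  \<comment> \<open>A small vector is a difference of two elements of the closure, both near \<^term>\<open>w0\<close>.\<close>
  have small: "\<exists>x w'. (x, w') \<in> G \<and> norm x \<le> 2 * real n \<and> norm (w - w') < e"
    if w: "w \<in> ?R" "norm w < r" and e: "e > 0" for w e
  proof -
    have "w0 + w \<in> closure (E n)"
      using U r w w0 subspace_add[OF subR] by (auto simp: dist_norm subset_iff)
    then obtain w1 where w1: "w1 \<in> E n" "dist w1 (w0 + w) < e / 2"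
      using closure_approachable e half_gt_zero by metis
    obtain w2 where w2: "w2 \<in> E n" "dist w2 w0 < e / 2"
      using w0(2) closure_approachable e half_gt_zero by metis
    obtain x1 x2 where x: "(x1, w1) \<in> G" "norm x1 \<le> n" "(x2, w2) \<in> G" "norm x2 \<le> n"
      using w1 w2 by (auto simp: E_def)
    have "(x1 - x2, w1 - w2) \<in> G" using subspace_diff[OF sub x(1,3)] by simp
    moreover have "norm (x1 - x2) \<le> 2 * real n" using x norm_triangle_ineq4[of x1 x2] by linarith
    moreover have "norm (w - (w1 - w2)) < e"
    proof -
      have "w - (w1 - w2) = (w2 - w0) - (w1 - (w0 + w))" by simp
      then have "norm (w - (w1 - w2)) \<le> norm (w2 - w0) + norm (w1 - (w0 + w))"
        by (metis norm_triangle_ineq4)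
      then show ?thesis using w1(2) w2(2) by (simp add: dist_norm)
    qed
    ultimately show ?thesis by blast
  qed
  have "\<exists>x w'. (x, w') \<in> G \<and> norm x \<le> C * norm w \<and> norm (w - w') < e"
    if w: "w \<in> ?R" and e: "e > 0" for w e
  proof (cases "w = 0")
    case True
    then show ?thesis using subspace_0[OF sub] e by (intro exI[of _ 0]) (simp add: zero_prod_def)
  next
    case False
    define s where "s = r / (2 * norm w)"
    have s: "s > 0" using False r by (simp add: s_def)
    have "norm (s *\<^sub>R w) < r" using False r by (simp add: s_def)
    then obtain x w' where x: "(x, w') \<in> G" "norm x \<le> 2 * real n" "norm (s *\<^sub>R w - w') < s * e"
      using small[of "s *\<^sub>R w" "s * e"] s e subspace_scale[OF subR w] by auto
    have "((1/s) *\<^sub>R x, (1/s) *\<^sub>R w') \<in> G" using subspace_scale[OF sub x(1), of "1/s"] by simp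
    moreover have "norm ((1/s) *\<^sub>R x) \<le> C * norm w"
    proof -
      have "norm ((1/s) *\<^sub>R x) = norm x / s" using s by simp
      also have "\<dots> \<le> 2 * real n / s" using x(2) s by (simp add: divide_right_mono)
      also have "\<dots> = C * norm w" using False r by (simp add: C_def s_def)
      finally show ?thesis .
    qed
    moreover have "norm (w - (1/s) *\<^sub>R w') < e"
    proof -
      have "w - (1/s) *\<^sub>R w' = (1/s) *\<^sub>R (s *\<^sub>R w - w')" using s by (simp add: algebra_simps)
      then have "norm (w - (1/s) *\<^sub>R w') = norm (s *\<^sub>R w - w') / s" using s by simp
      then show ?thesis using x(3) s by (metis mult.commute pos_divide_less_eq)
    qed
    ultimately show ?thesis by blast
  qed
  moreover have "C \<ge> 0" using r by (simp add: C_def)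
  ultimately show ?thesis using that by blast
qed

text \<open>The open mapping theorem for closed linear relations.  Approximate preimages of the successive
  remainders, halved in norm at every step, sum up to an exact preimage.\<close>

lemma closed_relation_preimage_bound:
  fixes G :: "('a::banach \<times> 'b::banach) set"
  assumes sub: "subspace G" and clG: "closed G" and cl: "closed (snd ` G)"
  obtains C where "\<And>w. w \<in> snd ` G \<Longrightarrow> \<exists>x. (x, w) \<in> G \<and> norm x \<le> C * norm w"
proof -
  let ?R = "snd ` G"
  have subR: "subspace ?R" by (intro linear_subspace_image sub linear_snd)
  obtain C where C: "C \<ge> 0" and approx: "\<And>w e. w \<in> ?R \<Longrightarrow> e > 0 \<Longrightarrow>
      \<exists>x w'. (x, w') \<in> G \<and> norm x \<le> C * norm w \<and> norm (w - w') < e"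
    using approx_preimage_bound[OF sub cl] by metis
  have "\<exists>x. (x, w) \<in> G \<and> norm x \<le> 2 * C * norm w" if w: "w \<in> ?R" for w
  proof (cases "w = 0")
    case True
    then show ?thesis using subspace_0[OF sub] by (intro exI[of _ 0]) (simp add: zero_prod_def)
  next
    case False
    have "\<forall>n v. \<exists>x w'. v \<in> ?R \<longrightarrow> (x, w') \<in> G \<and> norm x \<le> C * norm v
        \<and> norm (v - w') < norm w * (1/2) ^ Suc n"
    proof (intro allI)
      fix n v
      show "\<exists>x w'. v \<in> ?R \<longrightarrow> (x, w') \<in> G \<and> norm x \<le> C * norm v
          \<and> norm (v - w') < norm w * (1/2) ^ Suc n"
        using approx[of v "norm w * (1/2) ^ Suc n"] False by auto
    qed
    then obtain X W where XW: "\<And>v n. v \<in> ?R \<Longrightarrow> (X n v, W n v) \<in> G"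
      "\<And>v n. v \<in> ?R \<Longrightarrow> norm (X n v) \<le> C * norm v"
      "\<And>v n. v \<in> ?R \<Longrightarrow> norm (v - W n v) < norm w * (1/2) ^ Suc n"
      unfolding choice_iff by blast
    define r where "r = rec_nat w (\<lambda>n v. v - W n v)"
    have r0: "r 0 = w" and rS: "r (Suc n) = r n - W n (r n)" for n by (simp_all add: r_def)
    have rR: "r n \<in> ?R" for n
    proof (induction n)
      case (Suc n)
      then have "W n (r n) \<in> ?R" using XW(1) by force
      then show ?case using Suc subspace_diff[OF subR] by (simp add: rS)
    qed (simp add: r0 w)
    have rn: "norm (r n) \<le> norm w * (1/2) ^ n" for n
      using XW(3)[OF rR, of "n - 1" "n - 1"] by (cases n) (simp_all add: r0 rS)
    define x where "x n = X n (r n)" for n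
    have xn: "norm (x n) \<le> C * norm w * (1/2) ^ n" for n
      using XW(2)[OF rR, of n n] rn[of n] C
      by (metis (no_types, lifting) x_def mult.assoc mult_left_mono order_trans)
    have geo: "(\<lambda>n. C * norm w * (1/2::real) ^ n) sums (C * norm w * 2)"
      using sums_mult[OF geometric_sums[of "1/2::real"], of "C * norm w"] by simp
    have sumx: "summable x" using summable_comparison_test'[OF sums_summable[OF geo]] xn by blast
    have part: "(\<Sum>k<n. x k, w - r n) \<in> G" for n
    proof (induction n)
      case 0
      then show ?case using subspace_0[OF sub] by (simp add: r0 zero_prod_def)
    next
      case (Suc n)
      show ?case using subspace_add[OF sub Suc XW(1)[OF rR, of n n]]
        by (simp add: rS x_def algebra_simps)
    qed
    have "r \<longlonglongrightarrow> 0"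
    proof (rule Lim_null_comparison)
      show "\<forall>\<^sub>F n in sequentially. norm (r n) \<le> norm w * (1/2) ^ n" using rn by simp
      show "(\<lambda>n. norm w * (1/2) ^ n) \<longlonglongrightarrow> 0"
        by (intro tendsto_mult_right_zero LIMSEQ_power_zero) simp
    qed
    then have "(\<lambda>n. (\<Sum>k<n. x k, w - r n)) \<longlonglongrightarrow> (suminf x, w - 0)"
      by (intro tendsto_intros summable_LIMSEQ sumx)
    then have "(suminf x, w - 0) \<in> G" by (rule closed_sequentially[OF clG part])
    then have "(suminf x, w) \<in> G" by simp
    moreover have "norm (suminf x) \<le> 2 * C * norm w"
      using norm_suminf_le[OF xn sums_summable[OF geo]]
        sums_unique[OF geo] by simp
    ultimately show ?thesis by blast
  qed
  then show ?thesis by (rule that)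
qed

section \<open>Complex Hilbert spaces\<close>

lemma cinner_add_left: "cinner (x + y) z = cinner x z + cinner y z"
  by (metis cinner_add_right cinner_commute complex_cnj_add)

lemma cinner_scaleC_left: "cinner (c *\<^sub>C x) y = cnj c * cinner x y"
  by (metis cinner_commute cinner_scaleC_right complex_cnj_mult)

lemma cinner_zero_right [simp]: "cinner x 0 = 0"
  using cinner_add_right[of x 0 0] by simp

lemma cinner_zero_left [simp]: "cinner 0 x = 0"
  using cinner_add_left[of 0 0 x] by simp

lemma cinner_minus_right: "cinner x (- y) = - cinner x y"
  using cinner_add_right[of x y "- y"] by (simp add: add_eq_0_iff)

lemma cinner_diff_right: "cinner x (y - z) = cinner x y - cinner x z"
  using cinner_add_right[of x y "- z"] by (simp add: cinner_minus_right)

lemma cinner_diff_left: "cinner (x - y) z = cinner x z - cinner y z"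
  by (metis cinner_diff_right cinner_commute complex_cnj_diff)

lemma norm_scaleC: "norm (c *\<^sub>C x) = cmod c * norm (x::'a::chilbert_space)"
proof -
  have "(norm (c *\<^sub>C x))\<^sup>2 = Re ((c * cnj c) * cinner x x)"
    by (simp add: power2_norm_eq_inner inner_eq_Re_cinner cinner_scaleC_left
        cinner_scaleC_right mult.left_commute mult.commute)
  also have "\<dots> = (cmod c)\<^sup>2 * (norm x)\<^sup>2"
    by (simp add: complex_norm_square[symmetric] power2_norm_eq_inner[of x] inner_eq_Re_cinner
        flip: of_real_power)
  finally show ?thesis by (metis norm_ge_zero power2_eq_iff_nonneg power_mult_distrib mult_nonneg_nonneg)
qed

lemma cmod_cinner_le: "cmod (cinner x y) \<le> norm x * norm y"
proof (cases "cinner x y = 0")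
  case False
  define c where "c = cnj (cinner x y) / cmod (cinner x y)"
  have "cmod c = 1" using False by (simp add: c_def norm_divide)
  have "c * cinner x y = cmod (cinner x y)"
    using False complex_norm_square[of "cinner x y"]
    by (simp add: c_def field_simps power2_eq_square)
  then have "cmod (cinner x y) = x \<bullet> (c *\<^sub>C y)"
    by (simp add: inner_eq_Re_cinner cinner_scaleC_right)
  also have "\<dots> \<le> norm x * norm (c *\<^sub>C y)" by (rule norm_cauchy_schwarz)
  finally show ?thesis by (simp add: norm_scaleC \<open>cmod c = 1\<close>)
qed simp

lemma csubspace_imp_subspace: "csubspace S \<Longrightarrow> subspace S"
  unfolding csubspace_def subspace_def by (metis scaleC_of_real)

lemma csubspace_diff: "csubspace S \<Longrightarrow> x \<in> S \<Longrightarrow> y \<in> S \<Longrightarrow> x - y \<in> S"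
  using csubspace_imp_subspace subspace_diff by blast

lemma clinear_on_scaleR: "clinear_on S f \<Longrightarrow> x \<in> S \<Longrightarrow> f (r *\<^sub>R x) = r *\<^sub>R f x"
  unfolding clinear_on_def by (metis scaleC_of_real)

lemma clinear_on_diff:
  assumes "clinear_on S f" "csubspace S" "x \<in> S" "y \<in> S"
  shows "f (x - y) = f x - f y"
proof -
  have "f x = f ((x - y) + y)" by simp
  also have "\<dots> = f (x - y) + f y"
    using assms csubspace_diff unfolding clinear_on_def by blast
  finally show ?thesis by simp
qed

text \<open>The imaginary part of \<^term>\<open>cinner x s\<close> is a real part at \<^term>\<open>\<i> *\<^sub>C s\<close>, so on complex
  subspaces the real inner product decides equality of functionals.\<close>

lemma cinner_eq_if_inner_eq:
  assumes "csubspace S" "\<And>s. s \<in> S \<Longrightarrow> x \<bullet> s = y \<bullet> s" "s \<in> S"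
  shows "cinner x s = cinner y s"
proof -
  have "\<i> *\<^sub>C s \<in> S" using assms unfolding csubspace_def by blast
  then have "Re (cinner x (\<i> *\<^sub>C s)) = Re (cinner y (\<i> *\<^sub>C s))" "Re (cinner x s) = Re (cinner y s)"
    using assms(2,3) by (simp_all flip: inner_eq_Re_cinner)
  then show ?thesis by (simp add: cinner_scaleC_right complex_eq_iff)
qed

lemma ex_projection:
  assumes "csubspace S" "closed S"
  obtains p where "p \<in> S" "\<And>s. s \<in> S \<Longrightarrow> cinner p s = cinner x s"
proof -
  obtain p where p: "p \<in> S" "\<And>s. s \<in> S \<Longrightarrow> (x - p) \<bullet> s = 0"
    using orthogonal_projection[OF csubspace_imp_subspace] assms by metis
  then have "cinner p s = cinner x s" if "s \<in> S" for s
    using cinner_eq_if_inner_eq[OF assms(1), of p x] that by (simp add: inner_diff_left)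
  with p show ?thesis using that by blast
qed

lemma cinner_eq_on_imp_eq:
  assumes "csubspace S" "x \<in> S" "y \<in> S" "\<And>s. s \<in> S \<Longrightarrow> cinner x s = cinner y s"
  shows "x = y"
proof -
  have "(x - y) \<bullet> (x - y) = 0"
    using assms(4)[OF csubspace_diff[OF assms(1-3)]]
    by (simp add: inner_eq_Re_cinner cinner_diff_left)
  then show ?thesis by simp
qed

lemma embed_adj:
  assumes "csubspace S" "closed S"
  shows embed_adj_in: "embed_adj S x \<in> S"
    and cinner_embed_adj: "s \<in> S \<Longrightarrow> cinner (embed_adj S x) s = cinner x s"
proof -
  obtain p where p: "p \<in> S" "\<And>s. s \<in> S \<Longrightarrow> cinner p s = cinner x s"
    using ex_projection[OF assms] by metis
  have "embed_adj S x = p"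
    unfolding embed_adj_def
    by (rule the_equality) (use p cinner_eq_on_imp_eq[OF assms(1)] in auto)
  with p show "embed_adj S x \<in> S" "s \<in> S \<Longrightarrow> cinner (embed_adj S x) s = cinner x s" by auto
qed

lemma block_eq_iff:
  assumes "csubspace S" "closed S" "h \<in> S"
  shows "block S a x = h \<longleftrightarrow> (\<forall>s\<in>S. cinner (a x) s = cinner h s)"
  using cinner_embed_adj[OF assms(1,2)] embed_adj_in[OF assms(1,2)]
    cinner_eq_on_imp_eq[OF assms(1) _ assms(3)]
  unfolding block_def by metis

section \<open>Densely defined closed operators\<close>

context
  fixes A :: "'a::chilbert_space \<rightharpoonup> 'b::chilbert_space"
  assumes A: "densely_defined_closed A"
begin

lemma csubspace_dom: "csubspace (dom A)" and clinear_on_app: "clinear_on (dom A) (app A)"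
  using A by (auto simp: densely_defined_closed_def linear_op_def)

lemma adj_eq_Some_iff: "adj A y = Some z \<longleftrightarrow> (\<forall>x\<in>dom A. cinner (app A x) y = cinner x z)"
proof -
  have unique: "z = z'"
    if "\<forall>x\<in>dom A. cinner (app A x) y = cinner x z" "\<forall>x\<in>dom A. cinner (app A x) y = cinner x z'"
    for z z'
  proof -
    have "dom A \<subseteq> {x. x \<bullet> (z - z') = 0}"
    proof
      fix x assume "x \<in> dom A"
      then have "cinner x z = cinner x z'" using that by metis
      then show "x \<in> {x. x \<bullet> (z - z') = 0}" by (simp add: inner_eq_Re_cinner cinner_diff_right)
    qed
    then have "closure (dom A) \<subseteq> {x. x \<bullet> (z - z') = 0}"
      by (rule closure_minimal) (intro closed_Collect_eq continuous_intros)
    moreover have "closure (dom A) = UNIV" using A by (simp add: densely_defined_closed_def)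
    ultimately have "(z - z') \<bullet> (z - z') = 0" by blast
    then show ?thesis by simp
  qed
  show ?thesis
  proof
    assume *: "\<forall>x\<in>dom A. cinner (app A x) y = cinner x z"
    then have "(THE z. \<forall>x\<in>dom A. cinner (app A x) y = cinner x z) = z"
      by (rule the_equality) (use * unique in blast)
    then show "adj A y = Some z" using * unfolding adj_def by auto
  next
    assume "adj A y = Some z"
    then obtain w where w: "\<forall>x\<in>dom A. cinner (app A x) y = cinner x w"
      and z: "z = (THE z. \<forall>x\<in>dom A. cinner (app A x) y = cinner x z)"
      unfolding adj_def by (auto split: if_splits)
    have "z = w" unfolding z by (rule the_equality) (use w unique in blast)+
    then show "\<forall>x\<in>dom A. cinner (app A x) y = cinner x z" using w by simp
  qed
qed

lemma cinner_app_adj: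
  assumes "x \<in> dom A" "y \<in> dom (adj A)"
  shows "cinner (app A x) y = cinner x (app (adj A) y)"
proof -
  have "adj A y = Some (app (adj A) y)" using assms(2) by auto
  then show ?thesis using assms(1) unfolding adj_eq_Some_iff by blast
qed

lemma clinear_on_adj: "clinear_on (dom (adj A)) (app (adj A))"
proof -
  have "app (adj A) (x + y) = app (adj A) x + app (adj A) y"
    if "x \<in> dom (adj A)" "y \<in> dom (adj A)" for x y
  proof -
    have "adj A (x + y) = Some (app (adj A) x + app (adj A) y)"
      using that by (simp add: adj_eq_Some_iff cinner_add_right cinner_app_adj)
    then show ?thesis by simp
  qed
  moreover have "app (adj A) (c *\<^sub>C x) = c *\<^sub>C app (adj A) x" if "x \<in> dom (adj A)" for c x
  proof -
    have "adj A (c *\<^sub>C x) = Some (c *\<^sub>C app (adj A) x)"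
      using that by (simp add: adj_eq_Some_iff cinner_scaleC_right cinner_app_adj)
    then show ?thesis by simp
  qed
  ultimately show ?thesis unfolding clinear_on_def by blast
qed

lemma csubspace_ran: "csubspace (ran A)"
proof -
  have ran: "ran A = app A ` dom A" by (force simp: ran_def dom_def)
  have "0 \<in> dom A" using csubspace_dom by (simp add: csubspace_def)
  moreover from this have "app A 0 = 0" using clinear_on_scaleR[OF clinear_on_app, of 0 0] by simp
  ultimately have "0 \<in> ran A" unfolding ran by force
  moreover have "v + w \<in> ran A" if vw: "v \<in> ran A" "w \<in> ran A" for v w
  proof -
    obtain x y where "x \<in> dom A" "y \<in> dom A" "v = app A x" "w = app A y"
      using vw unfolding ran by blast
    then have "x + y \<in> dom A" "v + w = app A (x + y)"
      using csubspace_dom clinear_on_app by (simp_all add: csubspace_def clinear_on_def)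
    then show ?thesis unfolding ran by blast
  qed
  moreover have "c *\<^sub>C v \<in> ran A" if v: "v \<in> ran A" for c v
  proof -
    obtain x where "x \<in> dom A" "v = app A x" using v unfolding ran by blast
    then have "c *\<^sub>C x \<in> dom A" "c *\<^sub>C v = app A (c *\<^sub>C x)"
      using csubspace_dom clinear_on_app by (simp_all add: csubspace_def clinear_on_def)
    then show ?thesis unfolding ran by blast
  qed
  ultimately show ?thesis unfolding csubspace_def by blast
qed

lemma csubspace_kernel: "csubspace (kernel A)"
proof -
  have "0 \<in> dom A" using csubspace_dom by (simp add: csubspace_def)
  moreover from this have "app A 0 = 0" using clinear_on_scaleR[OF clinear_on_app, of 0 0] by simp
  moreover have "c *\<^sub>C 0 = (0::'b)" for c :: complex using norm_scaleC[of c "0::'b"] by simp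
  ultimately show ?thesis
    using csubspace_dom clinear_on_app unfolding kernel_def csubspace_def clinear_on_def by simp
qed

lemma closed_kernel: "closed (kernel A)"
proof -
  have "kernel A = (\<lambda>x. (x, 0)) -` Map.graph A"
    by (auto simp: kernel_def Map.graph_def)
  moreover have "closed (Map.graph A)" using A by (simp add: densely_defined_closed_def)
  ultimately show ?thesis by (auto intro!: closed_vimage continuous_intros)
qed

lemma subspace_graph: "subspace (Map.graph A)"
proof -
  have g: "(x, y) \<in> Map.graph A \<longleftrightarrow> x \<in> dom A \<and> y = app A x" for x y
    by (auto simp: Map.graph_def)
  have "0 \<in> dom A" using csubspace_dom by (simp add: csubspace_def)
  moreover from this have "app A 0 = 0" using clinear_on_scaleR[OF clinear_on_app, of 0 0] by simp
  ultimately show ?thesis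
    using csubspace_imp_subspace[OF csubspace_dom] clinear_on_app clinear_on_scaleR[OF clinear_on_app]
    unfolding subspace_def clinear_on_def zero_prod_def by (simp add: g split_paired_all)
qed

text \<open>This is the closed range theorem.  If \<^term>\<open>y\<close> is orthogonal to the kernel, then
  \<^term>\<open>cinner x y\<close> depends on \<^term>\<open>app A x\<close> only; by the open mapping theorem it is a
  bounded functional of \<^term>\<open>app A x\<close>, and its Riesz vector is a preimage of \<^term>\<open>y\<close> under the
  adjoint.\<close>

lemma ran_adj:
  assumes cl: "closed (ran A)"
  shows "ran (adj A) = {y. \<forall>x\<in>kernel A. cinner x y = 0}"
proof (intro Set.equalityI subsetI)
  fix y assume "y \<in> ran (adj A)"
  then obtain z where "adj A z = Some y" by (auto simp: ran_def)
  then have "cinner (app A x) z = cinner x y" if "x \<in> dom A" for x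
    using that adj_eq_Some_iff by blast
  then show "y \<in> {y. \<forall>x\<in>kernel A. cinner x y = 0}" by (force simp: kernel_def)
next
  fix y assume "y \<in> {y. \<forall>x\<in>kernel A. cinner x y = 0}"
  then have y: "x \<bullet> y = 0" if "x \<in> kernel A" for x using that by (simp add: inner_eq_Re_cinner)
  have snd: "snd ` Map.graph A = ran A" by (force simp: ran_def Map.graph_def)
  have clG: "closed (Map.graph A)" using A by (simp add: densely_defined_closed_def)
  obtain C where C: "\<And>w. w \<in> ran A \<Longrightarrow> \<exists>x. (x, w) \<in> Map.graph A \<and> norm x \<le> C * norm w"
    using closed_relation_preimage_bound[OF subspace_graph clG] cl unfolding snd by metis
  then obtain B where B: "\<And>w. w \<in> ran A \<Longrightarrow> (B w, w) \<in> Map.graph A"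
    "\<And>w. w \<in> ran A \<Longrightarrow> norm (B w) \<le> C * norm w"
    by metis
  have dep: "B w \<bullet> y = x \<bullet> y" if "w \<in> ran A" "(x, w) \<in> Map.graph A" for w x
  proof -
    have "(B w - x, 0) \<in> Map.graph A"
      using subspace_diff[OF subspace_graph B(1)[OF that(1)] that(2)] by simp
    then have "B w - x \<in> kernel A" by (auto simp: kernel_def Map.graph_def)
    from y[OF this] show ?thesis by (simp add: inner_diff_left)
  qed
  have sub: "subspace (ran A)" using csubspace_imp_subspace csubspace_ran by blast
  obtain z where z: "\<And>w. w \<in> ran A \<Longrightarrow> B w \<bullet> y = z \<bullet> w"
  proof (rule riesz_on_closed_subspace[OF sub cl, of "\<lambda>w. B w \<bullet> y" "C * norm y"])
    fix v w assume vw: "v \<in> ran A" "w \<in> ran A"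
    have "(B v + B w, v + w) \<in> Map.graph A"
      using subspace_add[OF subspace_graph B(1)[OF vw(1)] B(1)[OF vw(2)]] by simp
    then show "B (v + w) \<bullet> y = B v \<bullet> y + B w \<bullet> y"
      using dep subspace_add[OF sub vw] by (simp add: inner_add_left)
  next
    fix r w assume w: "w \<in> ran A"
    have "(r *\<^sub>R B w, r *\<^sub>R w) \<in> Map.graph A"
      using subspace_scale[OF subspace_graph B(1)[OF w], of r] by simp
    then show "B (r *\<^sub>R w) \<bullet> y = r * (B w \<bullet> y)"
      using dep subspace_scale[OF sub w] by simp
  next
    fix w assume w: "w \<in> ran A"
    have "\<bar>B w \<bullet> y\<bar> \<le> norm (B w) * norm y" by (rule Cauchy_Schwarz_ineq2)
    also have "\<dots> \<le> C * norm w * norm y" using B(2)[OF w] by (simp add: mult_right_mono)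
    finally show "\<bar>B w \<bullet> y\<bar> \<le> C * norm y * norm w" by (simp add: mult_ac)
  qed (use that in blast)
  have Re: "y \<bullet> x = z \<bullet> app A x" if "x \<in> dom A" for x
  proof -
    have g: "(x, app A x) \<in> Map.graph A" using that by (auto simp: Map.graph_def)
    moreover have "app A x \<in> ran A" using g snd by force
    ultimately show ?thesis using dep[of "app A x" x] z[of "app A x"] by (simp add: inner_commute[of y])
  qed
  have "cinner (app A x) z = cinner x y" if x: "x \<in> dom A" for x
  proof -
    have "\<i> *\<^sub>C x \<in> dom A" "app A (\<i> *\<^sub>C x) = \<i> *\<^sub>C app A x"
      using csubspace_dom clinear_on_app x unfolding csubspace_def clinear_on_def by auto
    then have "Re (cinner y x) = Re (cinner z (app A x))"
      "Re (\<i> * cinner y x) = Re (\<i> * cinner z (app A x))"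
      using Re[of x] Re[of "\<i> *\<^sub>C x"] x by (simp_all add: inner_eq_Re_cinner cinner_scaleC_right)
    then have "cinner z (app A x) = cinner y x" by (simp add: complex_eq_iff)
    then show ?thesis by (metis cinner_commute)
  qed
  then have "adj A z = Some y" by (simp add: adj_eq_Some_iff)
  then show "y \<in> ran (adj A)" by (auto simp: ran_def)
qed

lemma csubspace_ran_adj: "closed (ran A) \<Longrightarrow> csubspace (ran (adj A))"
  by (simp add: ran_adj csubspace_def cinner_add_right cinner_scaleC_right)

lemma closed_ran_adj:
  assumes cl: "closed (ran A)"
  shows "closed (ran (adj A))"
proof -
  have "cinner x y = 0" if "\<forall>x\<in>kernel A. x \<bullet> y = 0" "x \<in> kernel A" for x y
    using cinner_eq_if_inner_eq[OF csubspace_kernel, of y 0 x] that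
    by (simp add: inner_commute cinner_commute[of x y])
  then have "y \<in> ran (adj A) \<longleftrightarrow> (\<forall>x\<in>kernel A. x \<bullet> y = 0)" for y
    unfolding ran_adj[OF cl] by (auto simp: inner_eq_Re_cinner)
  then have "ran (adj A) = (\<Inter>x\<in>kernel A. {y. x \<bullet> y = 0})" by auto
  then show ?thesis by (auto intro!: closed_INT closed_Collect_eq continuous_intros)
qed

text \<open>Removing the kernel component of a point, or the component orthogonal to the range, does not
  change its image; hence the reduced operators keep the full range.\<close>

lemma app_red0_image:
  assumes "closed (ran A)"
  shows "app A ` (dom A \<inter> ran (adj A)) = ran A"
proof
  show "app A ` (dom A \<inter> ran (adj A)) \<subseteq> ran A" by (force simp: ran_def)
  show "ran A \<subseteq> app A ` (dom A \<inter> ran (adj A))"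
  proof
    fix w assume "w \<in> ran A"
    then obtain x where x: "x \<in> dom A" "w = app A x" by (force simp: ran_def)
    obtain k where k: "k \<in> kernel A" "\<And>s. s \<in> kernel A \<Longrightarrow> cinner k s = cinner x s"
      using ex_projection[OF csubspace_kernel closed_kernel] by metis
    have "cinner s (x - k) = 0" if "s \<in> kernel A" for s
      using k(2)[OF that] by (metis cinner_commute cinner_diff_right right_minus_eq)
    then have "x - k \<in> ran (adj A)" by (simp add: ran_adj[OF assms])
    moreover have "x - k \<in> dom A" "app A (x - k) = w"
      using x k csubspace_diff[OF csubspace_dom] clinear_on_diff[OF clinear_on_app csubspace_dom]
      by (auto simp: kernel_def)
    ultimately show "w \<in> app A ` (dom A \<inter> ran (adj A))" by blast
  qed
qed

lemma app_red1_adj_image: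
  assumes "closed (ran A)"
  shows "app (adj A) ` (dom (adj A) \<inter> ran A) = ran (adj A)"
proof
  show "app (adj A) ` (dom (adj A) \<inter> ran A) \<subseteq> ran (adj A)" by (force simp: ran_def)
  show "ran (adj A) \<subseteq> app (adj A) ` (dom (adj A) \<inter> ran A)"
  proof
    fix y assume "y \<in> ran (adj A)"
    then obtain z where z: "adj A z = Some y" by (auto simp: ran_def)
    obtain p where p: "p \<in> ran A" "\<And>s. s \<in> ran A \<Longrightarrow> cinner p s = cinner z s"
      using ex_projection[OF csubspace_ran assms] by metis
    have "cinner (app A x) p = cinner x y" if "x \<in> dom A" for x
    proof -
      have "app A x \<in> ran A" using that by (force simp: ran_def)
      then have "cinner (app A x) p = cinner (app A x) z" using p(2) by (metis cinner_commute)
      then show ?thesis using z that adj_eq_Some_iff by simp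
    qed
    then have "adj A p = Some y" by (simp add: adj_eq_Some_iff)
    then show "y \<in> app (adj A) ` (dom (adj A) \<inter> ran A)" using p(1) by force
  qed
qed

end

section \<open>Limits of the block inverses\<close>

definition weak_limit :: "(nat \<Rightarrow> 'a::real_inner) \<Rightarrow> 'a \<Rightarrow> bool" where
  "weak_limit x w \<longleftrightarrow> (\<forall>z. (\<lambda>n. z \<bullet> x n) \<longlonglongrightarrow> z \<bullet> w)"

lemma weak_limitD: "weak_limit x w \<Longrightarrow> (\<lambda>n. z \<bullet> x n) \<longlonglongrightarrow> z \<bullet> w"
  by (simp add: weak_limit_def)

lemma weak_limit_unique:
  assumes "weak_limit x w" "weak_limit x w'"
  shows "w = w'"
proof -
  have "(w - w') \<bullet> w = (w - w') \<bullet> w'"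
    using LIMSEQ_unique assms weak_limitD by blast
  then have "(w - w') \<bullet> (w - w') = 0" by (simp add: inner_diff_right)
  then show ?thesis by simp
qed

lemma weak_limit_diff:
  "weak_limit x w \<Longrightarrow> weak_limit y v \<Longrightarrow> weak_limit (\<lambda>n. x n - y n) (w - v)"
  by (simp add: weak_limit_def inner_diff_right tendsto_diff)

text \<open>What nonlocal H-convergence says about one of the two blocks, freed from the
  operators that define the subspace: with \<^term>\<open>S\<close> the range of \<^term>\<open>A0\<close>, the vector
  \<^term>\<open>inv_into S (block S (c n)) h\<close> is \<^term>\<open>app A0 u\<close> for the solution \<^term>\<open>u\<close> of the
  variational problem with right-hand side \<^term>\<open>\<lambda>\<phi>. cinner h (app A0 \<phi>)\<close>.\<close>

definition block_limit ::
    "'a::chilbert_space set \<Rightarrow> (nat \<Rightarrow> 'a \<Rightarrow> 'a) \<Rightarrow> ('a \<Rightarrow> 'a) \<Rightarrow> bool" where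
  "block_limit S c a \<longleftrightarrow> (\<forall>h\<in>S. \<exists>w\<in>S.
     weak_limit (\<lambda>n. inv_into S (block S (c n)) h) w \<and>
     weak_limit (\<lambda>n. c n (inv_into S (block S (c n)) h)) (a w) \<and>
     block S a w = h)"

text \<open>The weak limit \<^term>\<open>T\<close> of the block inverses inherits the bound \<^term>\<open>1 / \<gamma>\<close>, which comes from
  coercivity of the blocks, and the coercivity of the inverses themselves.  By Lax--Milgram it is
  onto.\<close>

lemma block_limit_surj:
  fixes S :: "'a::chilbert_space set"
  assumes S: "csubspace S" "closed S"
    and inv: "\<And>n. cont_invertible_on S (block S (c n))"
    and coercive: "\<And>n. Re_ge_on S (block S (c n)) \<gamma>" "\<gamma> > 0"
    and coercive_inv: "\<And>n. Re_ge_on S (inv_into S (block S (c n))) \<delta>" "\<delta> > 0"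
    and lim: "block_limit S c a"
    and y: "y \<in> S"
  obtains h where "h \<in> S" "weak_limit (\<lambda>n. inv_into S (block S (c n)) h) y"
proof -
  define T' where "T' n = inv_into S (block S (c n))" for n
  obtain T where T: "\<And>h. h \<in> S \<Longrightarrow> T h \<in> S" "\<And>h. h \<in> S \<Longrightarrow> weak_limit (\<lambda>n. T' n h) (T h)"
    using lim unfolding block_limit_def T'_def by metis
  have bij: "bij_betw (block S (c n)) S S" for n using inv by (simp add: cont_invertible_on_def)
  have T'S: "T' n h \<in> S" "block S (c n) (T' n h) = h" if "h \<in> S" for n h
    using bij[of n] that unfolding T'_def bij_betw_def
    by (simp_all add: inv_into_into f_inv_into_f)
  have T'_diff: "T' n (h - k) = T' n h - T' n k" if "h \<in> S" "k \<in> S" for n h k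
    using inv[of n] that unfolding T'_def cont_invertible_on_def bounded_ops_def
    by (intro clinear_on_diff[OF _ S(1)]) auto
  have T'_bound: "norm (T' n h) \<le> norm h / \<gamma>" if h: "h \<in> S" for n h
  proof (cases "T' n h = 0")
    case False
    have "\<gamma> * (norm (T' n h))\<^sup>2 \<le> h \<bullet> T' n h"
      using coercive(1)[of n] T'S[OF h, of n] by (force simp: Re_ge_on_def inner_eq_Re_cinner)
    also have "\<dots> \<le> norm h * norm (T' n h)" by (rule norm_cauchy_schwarz)
    finally show ?thesis using False coercive(2) by (simp add: power2_eq_square field_simps)
  qed (use coercive in simp)
  obtain h where "h \<in> S" "T h = y"
  proof (rule coercive_imp_surj[OF csubspace_imp_subspace[OF S(1)] S(2), of T "1 / \<gamma>" \<delta> y])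
    fix h k assume hk: "h \<in> S" "k \<in> S"
    show "T (h - k) = T h - T k"
      using weak_limit_unique[OF T(2)[OF csubspace_diff[OF S(1) hk]]]
        weak_limit_diff[OF T(2)[OF hk(1)] T(2)[OF hk(2)]] hk by (simp add: T'_diff)
  next
    fix h assume h: "h \<in> S"
    have "(norm (T h))\<^sup>2 \<le> norm (T h) * (norm h / \<gamma>)"
      unfolding power2_norm_eq_inner
    proof (rule LIMSEQ_le_const2[OF weak_limitD[OF T(2)[OF h]]], intro exI allI impI)
      fix n
      have "T h \<bullet> T' n h \<le> norm (T h) * norm (T' n h)" by (rule norm_cauchy_schwarz)
      also have "\<dots> \<le> norm (T h) * (norm h / \<gamma>)"
        by (intro mult_left_mono T'_bound[OF h] norm_ge_zero)
      finally show "T h \<bullet> T' n h \<le> norm (T h) * (norm h / \<gamma>)" .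
    qed
    then have "norm (T h) * norm (T h) \<le> norm (T h) * (1 / \<gamma> * norm h)"
      by (simp add: power2_eq_square)
    then show "norm (T h) \<le> 1 / \<gamma> * norm h"
      using coercive(2) mult_le_cancel_left_pos[of "norm (T h)" "norm (T h)" "1 / \<gamma> * norm h"]
      by (cases "T h = 0") simp_all
    have "\<delta> * (norm h)\<^sup>2 \<le> h \<bullet> T h"
    proof (rule LIMSEQ_le_const[OF weak_limitD[OF T(2)[OF h]]], intro exI allI impI)
      fix n
      have "\<delta> * (norm h)\<^sup>2 \<le> T' n h \<bullet> h"
        using coercive_inv(1)[of n] h by (simp add: Re_ge_on_def inner_eq_Re_cinner T'_def)
      then show "\<delta> * (norm h)\<^sup>2 \<le> h \<bullet> T' n h" by (simp add: inner_commute)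
    qed
    then show "\<delta> * (norm h)\<^sup>2 \<le> T h \<bullet> h" by (simp add: inner_commute)
  qed (use T(1) y coercive_inv(2) that in auto)
  then show ?thesis using that T(2) unfolding T'_def by blast
qed

lemma block_limit_unique:
  fixes S :: "'a::chilbert_space set"
  assumes S: "csubspace S" "closed S"
    and inv: "\<And>n. cont_invertible_on S (block S (c n))"
    and coercive: "\<And>n. Re_ge_on S (block S (c n)) \<gamma>" "\<gamma> > 0"
    and coercive_inv: "\<And>n. Re_ge_on S (inv_into S (block S (c n))) \<delta>" "\<delta> > 0"
    and lim: "block_limit S c a" "block_limit S c b"
    and y: "y \<in> S"
  shows "a y = b y"
proof -
  let ?x = "\<lambda>h n. inv_into S (block S (c n)) h"
  obtain h where h: "h \<in> S" "weak_limit (?x h) y"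
    using block_limit_surj[OF S inv coercive coercive_inv lim(1) y] by metis
  obtain w where w: "weak_limit (?x h) w" "weak_limit (\<lambda>n. c n (?x h n)) (a w)"
    using lim(1) h(1) unfolding block_limit_def by blast
  obtain v where v: "weak_limit (?x h) v" "weak_limit (\<lambda>n. c n (?x h n)) (b v)"
    using lim(2) h(1) unfolding block_limit_def by blast
  have "w = y" "v = y" using weak_limit_unique h(2) w(1) v(1) by blast+
  then show ?thesis using weak_limit_unique w(2) v(2) by blast
qed

section \<open>From variational problems to blocks\<close>

lemma cinner_app_in_dual:
  assumes "clinear_on (dom B) (app B)"
  shows "(\<lambda>\<phi>. cinner h (app B \<phi>)) \<in> dual (dom (B |` D)) (graph_norm (B |` D))"
proof -
  have "clinear_on (dom (B |` D)) (\<lambda>\<phi>. cinner h (app B \<phi>))"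
    using assms
    by (auto simp: clinear_on_def cinner_add_right cinner_scaleC_right scaleC_complex_def)
  moreover have "cmod (cinner h (app B \<phi>)) \<le> norm h * graph_norm (B |` D) \<phi>"
    if "\<phi> \<in> dom (B |` D)" for \<phi>
  proof -
    have "norm (app B \<phi>) \<le> graph_norm (B |` D) \<phi>"
      using that by (auto simp: graph_norm_def intro!: real_le_rsqrt)
    then show ?thesis
      by (meson cmod_cinner_le mult_left_mono norm_ge_zero order_trans)
  qed
  ultimately show ?thesis unfolding dual_def by blast
qed

lemma weak_limit_app:
  assumes "clinear_on (dom B) (app B)" "weakly_converges (dom B) (graph_norm B) u l"
  shows "weak_limit (\<lambda>n. app B (u n)) (app B l)"
proof -
  have "(\<lambda>n. cinner z (app B (u n))) \<longlonglongrightarrow> cinner z (app B l)" for z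
    using cinner_app_in_dual[OF assms(1), of z UNIV] assms(2)
    unfolding weakly_converges_def by (auto simp: restrict_map_def)
  then show ?thesis unfolding weak_limit_def inner_eq_Re_cinner by (intro allI tendsto_Re)
qed

lemma weak_limit_if_weakly_converges:
  assumes "weakly_converges UNIV norm x w"
  shows "weak_limit x w"
proof -
  have "cinner z \<in> dual UNIV norm" for z :: 'a
    unfolding dual_def clinear_on_def
    by (auto simp: cinner_add_right cinner_scaleC_right scaleC_complex_def intro!: exI cmod_cinner_le)
  then have "(\<lambda>n. cinner z (x n)) \<longlonglongrightarrow> cinner z w" for z
    using assms unfolding weakly_converges_def by blast
  then show ?thesis unfolding weak_limit_def inner_eq_Re_cinner by (intro allI tendsto_Re)
qed

lemma ex_var_solution:
  assumes S: "csubspace S" "closed S" "app B ` (dom B \<inter> D) = S"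
    and inv: "cont_invertible_on S (block S c)" and h: "h \<in> S"
  obtains u where "var_solution (B |` D) c (\<lambda>\<phi>. cinner h (app B \<phi>)) u"
    "u \<in> dom B \<inter> D" "app B u = inv_into S (block S c) h"
proof -
  define x where "x = inv_into S (block S c) h"
  have "block S c ` S = S" using inv by (simp add: cont_invertible_on_def bij_betw_def)
  then have x: "x \<in> S" "block S c x = h" using h unfolding x_def
    by (simp_all add: inv_into_into f_inv_into_f)
  then obtain u where u: "u \<in> dom B \<inter> D" "app B u = x" using S(3) by blast
  have "cinner (c x) s = cinner h s" if "s \<in> S" for s
    using x(2) that unfolding block_eq_iff[OF S(1,2) h] by blast
  then have "var_solution (B |` D) c (\<lambda>\<phi>. cinner h (app B \<phi>)) u"
    using u S(3) unfolding var_solution_def by auto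
  with u show ?thesis using that x_def by blast
qed

text \<open>Convergence is a statement about pairs of right-hand sides; pairing with the zero functional
  separates the two problems.\<close>

lemma nonlocal_H_convergent_imp_block_limit:
  fixes A0 :: "'a::chilbert_space \<rightharpoonup> 'b::chilbert_space" and A1 :: "'b \<rightharpoonup> 'c::chilbert_space"
  assumes A0: "densely_defined_closed A0" and A1: "densely_defined_closed A1"
    and exact: "closed_exact A0 A1"
    and M: "\<And>n. an n \<in> M_class \<alpha> \<beta> A0 A1"
    and conv: "nonlocal_H_convergent A0 A1 an a"
  shows "block_limit (ran A0) an a"
    and "block_limit (ran (adj A1)) (\<lambda>n. inv (an n)) (inv a)"
proof -
  let ?R0 = "ran A0" and ?R1 = "ran (adj A1)"
  have cl: "closed ?R0" "closed (ran A1)" using exact unfolding closed_exact_def by blast+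
  have R0: "csubspace ?R0" by (rule csubspace_ran[OF A0])
  have R1: "csubspace ?R1" "closed ?R1"
    using csubspace_ran_adj[OF A1 cl(2)] closed_ran_adj[OF A1 cl(2)] .
  have inv: "cont_invertible_on ?R0 (block ?R0 (an n))"
    "cont_invertible_on ?R1 (block ?R1 (inv (an n)))" for n
    using M[of n] by (simp_all add: M_class_def Let_def)
  have main: "\<exists>w0\<in>?R0. \<exists>w1\<in>?R1.
      weak_limit (\<lambda>n. inv_into ?R0 (block ?R0 (an n)) h0) w0 \<and>
      weak_limit (\<lambda>n. an n (inv_into ?R0 (block ?R0 (an n)) h0)) (a w0) \<and>
      block ?R0 a w0 = h0 \<and>
      weak_limit (\<lambda>n. inv_into ?R1 (block ?R1 (inv (an n))) h1) w1 \<and>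
      weak_limit (\<lambda>n. inv (an n) (inv_into ?R1 (block ?R1 (inv (an n))) h1)) (inv a w1) \<and>
      block ?R1 (inv a) w1 = h1"
    if h: "h0 \<in> ?R0" "h1 \<in> ?R1" for h0 h1
  proof -
    let ?f = "\<lambda>\<phi>. cinner h0 (app A0 \<phi>)" and ?g = "\<lambda>\<psi>. cinner h1 (app (adj A1) \<psi>)"
    have im0: "app A0 ` (dom A0 \<inter> ran (adj A0)) = ?R0" by (rule app_red0_image[OF A0 cl(1)])
    have im1: "app (adj A1) ` (dom (adj A1) \<inter> ran A1) = ?R1"
      by (rule app_red1_adj_image[OF A1 cl(2)])
    have "\<exists>u. var_solution (red0 A0) (an n) ?f u \<and>
        app A0 u = inv_into ?R0 (block ?R0 (an n)) h0" for n
      unfolding red0_def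
      by (rule ex_var_solution[OF R0 cl(1) im0 inv(1) h(1)]) blast
    then obtain u where u: "\<And>n. var_solution (red0 A0) (an n) ?f (u n)"
      "\<And>n. app A0 (u n) = inv_into ?R0 (block ?R0 (an n)) h0"
      by metis
    have "\<exists>v. var_solution (red1_adj A1) (inv (an n)) ?g v \<and>
        app (adj A1) v = inv_into ?R1 (block ?R1 (inv (an n))) h1" for n
      unfolding red1_adj_def
      by (rule ex_var_solution[OF R1 im1 inv(2) h(2)]) blast
    then obtain v where v: "\<And>n. var_solution (red1_adj A1) (inv (an n)) ?g (v n)"
      "\<And>n. app (adj A1) (v n) = inv_into ?R1 (block ?R1 (inv (an n))) h1"
      by metis
    have lin: "clinear_on (dom A0) (app A0)" "clinear_on (dom (adj A1)) (app (adj A1))"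
      using clinear_on_app[OF A0] clinear_on_adj[OF A1] .
    have fg: "?f \<in> dual (dom (red0 A0)) (graph_norm (red0 A0))"
      "?g \<in> dual (dom (red1_adj A1)) (graph_norm (red1_adj A1))"
      unfolding red0_def red1_adj_def by (intro cinner_app_in_dual lin)+
    obtain ul vl where l: "weakly_converges (dom A0) (graph_norm A0) u ul"
      "weakly_converges (dom (adj A1)) (graph_norm (adj A1)) v vl"
      "weakly_converges UNIV norm (\<lambda>n. an n (app A0 (u n))) (a (app A0 ul))"
      "weakly_converges UNIV norm
         (\<lambda>n. inv (an n) (app (adj A1) (v n))) (inv a (app (adj A1) vl))"
      "\<forall>\<phi>\<in>dom (red0 A0). cinner (a (app A0 ul)) (app A0 \<phi>) = ?f \<phi>"
      "\<forall>\<psi>\<in>dom (red1_adj A1). cinner (inv a (app (adj A1) vl)) (app (adj A1) \<psi>) = ?g \<psi>"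
      using conv[unfolded nonlocal_H_convergent_def, rule_format, OF fg, of u v] u(1) v(1)
      by blast
    have "app A0 ul \<in> ?R0" "app (adj A1) vl \<in> ?R1"
      using l(1,2) unfolding weakly_converges_def by (force simp: ran_def)+
    moreover have "\<forall>s\<in>app A0 ` (dom A0 \<inter> ran (adj A0)). cinner (a (app A0 ul)) s = cinner h0 s"
      using l(5) by (simp add: red0_def)
    then have "block ?R0 a (app A0 ul) = h0"
      unfolding im0 block_eq_iff[OF R0 cl(1) h(1)] .
    moreover have "\<forall>s\<in>app (adj A1) ` (dom (adj A1) \<inter> ran A1).
        cinner (inv a (app (adj A1) vl)) s = cinner h1 s"
      using l(6) by (simp add: red1_adj_def)
    then have "block ?R1 (inv a) (app (adj A1) vl) = h1"
      unfolding im1 block_eq_iff[OF R1 h(2)] .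
    ultimately show ?thesis
      using weak_limit_app[OF lin(1) l(1)] weak_limit_app[OF lin(2) l(2)]
        l(3,4)[THEN weak_limit_if_weakly_converges] unfolding u(2) v(2) by blast
  qed
  have "0 \<in> ?R0" "0 \<in> ?R1" using R0 R1 by (auto simp: csubspace_def)
  with main show "block_limit ?R0 an a" "block_limit ?R1 (\<lambda>n. inv (an n)) (inv a)"
    unfolding block_limit_def by blast+
qed

section \<open>Uniqueness of the nonlocal limit\<close>

theorem corollary4p4:
  fixes A0 :: "'a::chilbert_space \<rightharpoonup> 'b::chilbert_space"
    and A1 :: "'b \<rightharpoonup> 'c::chilbert_space"
    and \<alpha> \<beta> :: real
    and an :: "nat \<Rightarrow> 'b \<Rightarrow> 'b"
    and a b :: "'b \<Rightarrow> 'b"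
  assumes "densely_defined_closed A0" and "densely_defined_closed A1"
    and "closed_exact A0 A1"
    and "\<alpha> > 0" and "\<beta> > 0"
    and "\<And>n. an n \<in> M_class \<alpha> \<beta> A0 A1"
    and "cont_invertible_on UNIV a" and "cont_invertible_on UNIV b"
    and "nonlocal_H_convergent A0 A1 an a"
    and "nonlocal_H_convergent A0 A1 an b"
  shows "a = b"
proof
  fix x
  let ?R0 = "ran A0" and ?R1 = "ran (adj A1)"
  have cl: "closed ?R0" "closed (ran A1)" and R0_eq: "?R0 = kernel A1"
    using assms(3) unfolding closed_exact_def by blast+
  have R0: "csubspace ?R0" "closed ?R0" using csubspace_ran[OF assms(1)] cl(1) .
  have R1: "csubspace ?R1" "closed ?R1"
    using csubspace_ran_adj[OF assms(2) cl(2)] closed_ran_adj[OF assms(2) cl(2)] .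
  note M = assms(6)[unfolded M_class_def Let_def, THEN CollectD]
  note lim_a = nonlocal_H_convergent_imp_block_limit[OF assms(1-3,6,9)]
    and lim_b = nonlocal_H_convergent_imp_block_limit[OF assms(1-3,6,10)]
  have eq0: "a w = b w" if "w \<in> ?R0" for w
    by (rule block_limit_unique[OF R0 _ _ assms(4) _ _ lim_a(1) lim_b(1) that, of "1 / \<beta>"])
      (use M assms(5) in auto)
  have eq1: "inv a w = inv b w" if "w \<in> ?R1" for w
    by (rule block_limit_unique[OF R1 _ _ _ _ assms(4) lim_a(2) lim_b(2) that, of "1 / \<beta>"])
      (use M assms(5) in auto)
  have lin: "clinear_on UNIV a" "clinear_on UNIV b" and surj: "surj a" "surj b"
    using assms(7,8) by (auto simp: cont_invertible_on_def bounded_ops_def bij_betw_def)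
  \<comment> \<open>The block of \<^term>\<open>inv a\<close> on the second summand is onto, so modulo the first summand \<^term>\<open>x\<close> is
    \<^term>\<open>inv a w\<close> for some \<^term>\<open>w\<close> in the second one.\<close>
  obtain w where w: "w \<in> ?R1" "block ?R1 (inv a) w = embed_adj ?R1 x"
    using lim_a(2) embed_adj_in[OF R1, of x] unfolding block_limit_def by blast
  define r where "r = x - inv a w"
  have orth: "cinner r s = 0" if "s \<in> ?R1" for s
    using w(2) cinner_embed_adj[OF R1 that, of x] that
    unfolding block_eq_iff[OF R1 embed_adj_in[OF R1]] by (simp add: r_def cinner_diff_left)
  have "r \<in> ?R0"
  proof -
    obtain p where p: "p \<in> ?R0" "\<And>s. s \<in> ?R0 \<Longrightarrow> cinner p s = cinner r s"
      using ex_projection[OF R0, of r] by metis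
    have "cinner s (r - p) = 0" if "s \<in> kernel A1" for s
      using p(2) that R0_eq by (metis cinner_commute cinner_diff_right right_minus_eq)
    then have q: "r - p \<in> ?R1" unfolding ran_adj[OF assms(2) cl(2)] by simp
    then have "cinner p (r - p) = 0"
      using p(1) R0_eq unfolding ran_adj[OF assms(2) cl(2)] by simp
    then have "(r - p) \<bullet> (r - p) = 0"
      using orth[OF q] by (simp add: inner_eq_Re_cinner cinner_diff_left)
    then show ?thesis using p(1) by simp
  qed
  then have "a r = b r" by (rule eq0)
  moreover have "a (inv a w) = b (inv a w)"
    using eq1[OF w(1)] surj by (metis surj_f_inv_f)
  moreover have "x = r + inv a w" by (simp add: r_def)
  ultimately show "a x = b x" using lin unfolding clinear_on_def by simp
qed

end
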